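(* Let $p$ be an odd prime, $q\in\mathbb{C}_p$ with $|1-q|_p<p^{-1/(p-1)}$, and $\alpha,\beta\in\mathbb{Z}_+$. Then $g^{(\alpha,\beta)}_{0,q}=0$, and for $n\in\mathbb{N}$, \[ g^{(\alpha,\beta)}_{n,q}(1)+g^{(\alpha,\beta)}_{n,q}=\begin{cases}[2]_{q^{\beta}}, & n=1,\\ 0, & n>1.\end{cases} \]
   Context: $\mathbb{Z}_+=\mathbb{N}\cup\{0\}$. For $q\in\mathbb{C}_p$ with $|1-q|_p<p^{-1/(p-1)}$, $q^x=\exp(x\log q)$ for $|x|_p\le1$, $[x]_q=\frac{1-q^x}{1-q}$, $[x]_{-q}=\frac{1-(-q)^x}{1+q}$. For uniformly differentiable $f:\mathbb{Z}_p\to\mathbb{C}_p$, $\int_{\mathbb{Z}_p}f(x)\,d\mu_{-q}(x)=\lim_{N\to\infty}\frac{1}{[p^N]_{-q}}\sum_{x=0}^{p^N-1}f(x)(-q)^x$; $d\mu_{-q^\beta}$ is the same with $q$ replaced by $q^\beta$. For $n\in\mathbb{Z}_+$ the modified $q$-Genocchi polynomials with weight $(\alpha,\beta)$ are $\frac{g^{(\alpha,\beta)}_{n+1,q}(x)}{n+1}=\int_{\mathbb{Z}_p}q^{-\beta t}[x+t]_{q^{\alpha}}^{n}\,d\mu_{-q^{\beta}}(t)$ and the numbers are $g^{(\alpha,\beta)}_{n+1,q}=g^{(\alpha,\beta)}_{n+1,q}(0)$; the index-$0$ terms of the generating function $\sum_{n\ge0}g^{(\alpha,\beta)}_{n,q}(x)t^n/n!=t\int_{\mathbb{Z}_p}q^{-\beta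 y}e^{t[x+y]_{q^\alpha}}d\mu_{-q^\beta}(y)$ are the $t^0$ coefficients. *)

theory Defs
  imports "HOL-Analysis.Analysis" "HOL-Computational_Algebra.Computational_Algebra"
begin

section \<open>The field of p-adic complex numbers\<close>

text \<open>
  Complete non-Archimedean valued fields of characteristic 0. Definiteness of the absolute value
  and the triangle inequality are inherited from the metric. The absolute value is a separate
  class parameter because the constant \<open>norm\<close> is constrained to real normed vector spaces.
\<close>

class complete_nonarch_field = field_char_0 + complete_space +
  fixes vabs :: "'a \<Rightarrow> real"
  assumes dist_vabs: "dist x y = vabs (x - y)"
    and vabs_mult: "vabs (x * y) = vabs x * vabs y"
    and vabs_add: "vabs (x + y) \<le> max (vabs x) (vabs y)"

definition Qp :: "'a::complete_nonarch_field set" where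
  "Qp = closure \<rat>"

definition Qp_bar :: "'a::complete_nonarch_field set" where
  "Qp_bar = {x. \<exists>P :: 'a poly. P \<noteq> 0 \<and> (\<forall>i. coeff P i \<in> Qp) \<and> poly P x = 0}"

text \<open>
  The type \<open>'a\<close> is (a copy of) \<open>C\<^sub>p\<close>, the completion of an algebraic closure of \<open>Q\<^sub>p\<close>. The absolute value is
  the p-adic one on the rationals, so by completeness \<open>Qp\<close> is the field of p-adic numbers;
  the elements algebraic over it form an algebraically closed field; and this field is dense.
  These conditions determine \<open>'a\<close> up to isometric isomorphism.
\<close>

definition is_Cp :: "nat \<Rightarrow> 'a::complete_nonarch_field itself \<Rightarrow> bool" where
  "is_Cp p (_ :: 'a itself) \<longleftrightarrow>
     (\<forall>n>0. vabs (of_nat n :: 'a) = 1 / real p ^ multiplicity p n) \<and>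
     (\<forall>P :: 'a poly. degree P > 0 \<and> (\<forall>i. coeff P i \<in> Qp_bar) \<longrightarrow>
        (\<exists>x\<in>Qp_bar. poly P x = 0)) \<and>
     closure (Qp_bar :: 'a set) = UNIV"


section \<open>q-numbers\<close>

definition padic_exp :: "'a::complete_nonarch_field \<Rightarrow> 'a" where
  "padic_exp x = (\<Sum>n. x ^ n / fact n)"

definition padic_log :: "'a::complete_nonarch_field \<Rightarrow> 'a" where
  "padic_log x = (\<Sum>n. (-1) ^ n * (x - 1) ^ Suc n / of_nat (Suc n))"

text \<open>The power \<open>q\<^sup>x\<close>, meaningful for \<open>|1 - q| < p\<^bsup>-1/(p-1)\<^esup>\<close> and \<open>|x| \<le> 1\<close>.\<close>

definition qpow :: "'a::complete_nonarch_field \<Rightarrow> 'a \<Rightarrow> 'a" where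
  "qpow q x = padic_exp (x * padic_log q)"

text \<open>
  The q-number \<open>[x]\<^sub>q\<close>. At \<open>q = 1\<close> the quotient is \<open>0/0\<close> and is read as its limit \<open>x\<close>; this case
  occurs below for \<open>[x]\<close> with base \<open>q\<^sup>\<alpha>\<close> when \<open>\<alpha> = 0\<close> or \<open>q = 1\<close>.
\<close>

definition qnum :: "'a::complete_nonarch_field \<Rightarrow> 'a \<Rightarrow> 'a" where
  "qnum q x = (if q = 1 then x else (1 - qpow q x) / (1 - q))"

text \<open>
  The number \<open>[m]\<close> with base \<open>-q\<close>. Since \<open>-q\<close> is not close to 1, its powers are
  only available for natural exponents.
\<close>

definition qnum_neg :: "'a::complete_nonarch_field \<Rightarrow> nat \<Rightarrow> 'a" where
  "qnum_neg q m = (1 - (- q) ^ m) / (1 + q)"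


section \<open>The fermionic integral and the modified q-Genocchi polynomials\<close>

text \<open>
  The integral of \<open>f\<close> over \<open>Z\<^sub>p\<close> with respect to \<open>\<mu>\<close> at \<open>-q\<close>. Only the values of \<open>f\<close> on the
  natural numbers, viewed inside \<open>Z\<^sub>p\<close>, enter.
\<close>

definition fermionic_integral ::
    "nat \<Rightarrow> 'a::complete_nonarch_field \<Rightarrow> ('a \<Rightarrow> 'a) \<Rightarrow> 'a" where
  "fermionic_integral p q f =
     lim (\<lambda>N. 1 / qnum_neg q (p ^ N) * (\<Sum>x<p ^ N. f (of_nat x) * (- q) ^ x))"

text \<open>
  The generating function
  \<open>t \<integral> q\<^bsup>-\<beta>y\<^esup> exp (t [x + y]) d\<mu>(y)\<close>, as a formal power series in \<open>t\<close>, integrated coefficientwise;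
  the bracket has base \<open>q\<^sup>\<alpha>\<close> and the measure is taken at \<open>-q\<^sup>\<beta>\<close>.
\<close>

definition genocchi_gf ::
    "nat \<Rightarrow> nat \<Rightarrow> nat \<Rightarrow> 'a::complete_nonarch_field \<Rightarrow> 'a \<Rightarrow> 'a fps" where
  "genocchi_gf p \<alpha> \<beta> q x = fps_X * Abs_fps (\<lambda>n.
     fermionic_integral p (qpow q (of_nat \<beta>)) (\<lambda>y.
       fps_nth (fps_const (qpow q (- of_nat \<beta> * y)) *
                fps_exp (qnum (qpow q (of_nat \<alpha>)) (x + y))) n))"

text \<open>The integral formula defines the terms of positive index; the term of index 0 is the
  constant coefficient of the generating function.\<close>

definition genocchi_poly ::
    "nat \<Rightarrow> nat \<Rightarrow> nat \<Rightarrow> 'a::complete_nonarch_field \<Rightarrow> nat \<Rightarrow> 'a \<Rightarrow> 'a" where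
  "genocchi_poly p \<alpha> \<beta> q k x =
     (case k of
        0 \<Rightarrow> fps_nth (genocchi_gf p \<alpha> \<beta> q x) 0
      | Suc n \<Rightarrow> of_nat (n + 1) *
          fermionic_integral p (qpow q (of_nat \<beta>))
            (\<lambda>t. qpow q (- of_nat \<beta> * t) * qnum (qpow q (of_nat \<alpha>)) (x + t) ^ n))"

definition genocchi_num ::
    "nat \<Rightarrow> nat \<Rightarrow> nat \<Rightarrow> 'a::complete_nonarch_field \<Rightarrow> nat \<Rightarrow> 'a" where
  "genocchi_num p \<alpha> \<beta> q k = genocchi_poly p \<alpha> \<beta> q k 0"

end

theory Submission
  imports Defs
begin

text \<open>
  Since \<open>p\<close> is odd and \<open>Q = q\<^sup>\<beta>\<close> satisfies \<open>Q\<^bsup>p^N\<^esup> \<longlonglongrightarrow> 1\<close>, the integral of \<open>q\<^bsup>-\<beta>t\<^esup> f(t)\<close> at \<open>-Q\<close> is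
  \<open>(1 + Q) / 2\<close> times the limit of the alternating sums of \<open>f\<close> over \<open>x < p\<^sup>N\<close>. These sums converge
  because \<open>f\<close> is Lipschitz on the natural numbers, and adding those of \<open>f\<close> and of its shift by 1
  telescopes to \<open>f(0) + f(p\<^sup>N) \<longlonglongrightarrow> 2 f(0)\<close>. With \<open>f(x) = [x]\<^sup>n\<close> this leaves \<open>1 + Q\<close> for \<open>n = 0\<close> and
  \<open>0\<close> otherwise. Identifying \<open>1 + Q\<close> with \<open>[2]\<close> in base \<open>Q\<close> requires \<open>log (exp y) = y\<close>.
\<close>

section \<open>Non-Archimedean valued fields\<close>

lemma vabs_eq_dist: "vabs x = dist x 0"
  by (simp add: dist_vabs)

lemma vabs_zero [simp]: "vabs 0 = 0"
  by (simp add: vabs_eq_dist)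

lemma vabs_nonneg [simp]: "0 \<le> vabs x"
  by (simp add: vabs_eq_dist)

lemma vabs_le_0_iff [simp]: "vabs x \<le> 0 \<longleftrightarrow> x = 0"
  by (simp add: vabs_eq_dist)

lemma vabs_eq_0_iff [simp]: "vabs x = 0 \<longleftrightarrow> x = 0"
  by (simp add: vabs_eq_dist)

lemma vabs_pos_iff [simp]: "0 < vabs x \<longleftrightarrow> x \<noteq> 0"
  by (simp add: vabs_eq_dist)

lemma vabs_one [simp]: "vabs (1 :: 'a::complete_nonarch_field) = 1"
  using vabs_mult[of "1 :: 'a" 1] by simp

lemma vabs_power: "vabs (x ^ n) = vabs x ^ n"
  by (induction n) (auto simp: vabs_mult)

lemma vabs_minus [simp]: "vabs (- x) = vabs x"
proof -
  have "vabs (- 1 :: 'a) ^ 2 = 1"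
    by (simp flip: vabs_power)
  then have "vabs (- 1 :: 'a) = 1"
    by (simp add: power2_eq_1_iff) (metis vabs_nonneg neg_0_le_iff_le not_one_le_zero)
  then show ?thesis
    using vabs_mult[of "- 1" x] by simp
qed

lemma vabs_diff: "vabs (x - y) \<le> max (vabs x) (vabs y)"
  using vabs_add[of x "- y"] by simp

lemma vabs_minus_commute: "vabs (x - y) = vabs (y - x)"
  using vabs_minus[of "x - y"] by simp

lemma vabs_divide: "vabs (x / y) = vabs x / vabs y"
proof (cases "y = 0")
  case False
  then have "vabs (x / y) * vabs y = vabs x"
    by (simp flip: vabs_mult)
  then show ?thesis
    using False by (metis nonzero_eq_divide_eq vabs_eq_0_iff)
qed simp

lemma vabs_sum_le:
  assumes "\<And>i. i \<in> A \<Longrightarrow> vabs (f i) \<le> B" and "0 \<le> B"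
  shows "vabs (sum f A) \<le> B"
  using assms
proof (induction A rule: infinite_finite_induct)
  case (insert a A)
  then show ?case
    using vabs_add[of "f a" "sum f A"] by (force simp: max_def split: if_splits)
qed auto

lemma vabs_of_nat_le_1: "vabs (of_nat n :: 'a::complete_nonarch_field) \<le> 1"
proof (induction n)
  case (Suc n)
  then show ?case
    using vabs_add[of 1 "of_nat n :: 'a"] by (simp add: max_def split: if_splits)
qed simp

section \<open>Limits, continuity of the field operations and convergence of series\<close>

lemma tendsto_vabs_iff: "(f \<longlongrightarrow> a) F \<longleftrightarrow> ((\<lambda>x. vabs (f x - a)) \<longlongrightarrow> 0) F"
  by (simp add: tendsto_dist_iff[of f] dist_vabs)

lemma tendsto_of_vabs_le:
  assumes "\<And>x. vabs (f x - a) \<le> g x" and "(g \<longlongrightarrow> 0) F"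
  shows "(f \<longlongrightarrow> a) F"
  unfolding tendsto_vabs_iff
  by (rule tendsto_sandwich[OF _ _ tendsto_const assms(2)]) (auto simp: assms(1))

lemma tendsto_vabs: "(f \<longlongrightarrow> a) F \<Longrightarrow> ((\<lambda>x. vabs (f x)) \<longlongrightarrow> vabs a) F"
  unfolding vabs_eq_dist by (intro tendsto_intros)

text \<open>Makes the limit rules for sums and differences available. By the ultrametric inequality
  the error of a sum is at most the larger of the two errors.\<close>

instance complete_nonarch_field \<subseteq> topological_ab_group_add
proof
  fix a b :: 'a
  have fst: "((\<lambda>x. vabs (fst x - a)) \<longlongrightarrow> 0) (nhds a \<times>\<^sub>F nhds b)"
    and snd: "((\<lambda>x. vabs (snd x - b)) \<longlongrightarrow> 0) (nhds a \<times>\<^sub>F nhds b)"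
    by (simp_all add: tendsto_vabs_iff[symmetric] filterlim_fst filterlim_snd)
  have "vabs (fst x + snd x - (a + b)) \<le> max (vabs (fst x - a)) (vabs (snd x - b))" for x
    using vabs_add[of "fst x - a" "snd x - b"] by (simp add: algebra_simps)
  then show "((\<lambda>x. fst x + snd x) \<longlongrightarrow> a + b) (nhds a \<times>\<^sub>F nhds b)"
    using tendsto_max[OF fst snd] by (intro tendsto_of_vabs_le) auto
  have "vabs (- x - - a) \<le> vabs (x - a)" for x
    by (simp add: vabs_minus_commute[of a])
  then show "(uminus \<longlongrightarrow> - a) (nhds a)"
    by (rule tendsto_of_vabs_le) (simp add: tendsto_vabs_iff[symmetric] filterlim_ident)
qed

instance complete_nonarch_field \<subseteq> topological_comm_monoid_mult
proof
  fix a b :: 'a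
  have fst: "((\<lambda>x. fst x) \<longlongrightarrow> a) (nhds a \<times>\<^sub>F nhds b)"
    and snd: "((\<lambda>x. snd x) \<longlongrightarrow> b) (nhds a \<times>\<^sub>F nhds b)"
    by (simp_all add: filterlim_fst filterlim_snd)
  have bound: "vabs (fst x * snd x - a * b)
      \<le> max (vabs (fst x - a) * vabs (snd x)) (vabs a * vabs (snd x - b))" for x
    using vabs_add[of "(fst x - a) * snd x" "a * (snd x - b)"]
    by (simp add: algebra_simps flip: vabs_mult)
  have "((\<lambda>x. max (vabs (fst x - a) * vabs (snd x)) (vabs a * vabs (snd x - b)))
      \<longlongrightarrow> max (0 * vabs b) (vabs a * 0)) (nhds a \<times>\<^sub>F nhds b)"
    by (intro tendsto_intros tendsto_vabs snd tendsto_vabs_iff[THEN iffD1] fst)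
  with bound show "((\<lambda>x. fst x * snd x) \<longlongrightarrow> a * b) (nhds a \<times>\<^sub>F nhds b)"
    by (intro tendsto_of_vabs_le) auto
qed

text \<open>The difference of the inverses is \<open>(a - f x) / (f x * a)\<close>, and its
  denominator tends to the nonzero \<open>a * a\<close>.\<close>

lemma tendsto_nonarch_inverse:
  fixes f :: "'b \<Rightarrow> 'a::complete_nonarch_field"
  assumes "(f \<longlongrightarrow> a) F" and "a \<noteq> 0"
  shows "((\<lambda>x. inverse (f x)) \<longlongrightarrow> inverse a) F"
proof -
  have "eventually (\<lambda>x. f x \<noteq> 0) F"
    by (rule tendsto_imp_eventually_ne[OF assms])
  then have "eventually (\<lambda>x. vabs (f x - a) / (vabs (f x) * vabs a) = vabs (inverse (f x) - inverse a)) F"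
  proof eventually_elim
    case (elim x)
    then have "inverse (f x) - inverse a = (a - f x) / (f x * a)"
      using assms(2) by (simp add: field_simps)
    then show ?case
      by (simp add: vabs_divide vabs_mult vabs_minus_commute)
  qed
  moreover have "((\<lambda>x. vabs (f x - a) / (vabs (f x) * vabs a)) \<longlongrightarrow> 0 / (vabs a * vabs a)) F"
    using assms by (intro tendsto_intros tendsto_vabs tendsto_vabs_iff[THEN iffD1]) auto
  ultimately show ?thesis
    unfolding tendsto_vabs_iff[of "\<lambda>x. inverse (f x)"] by (simp add: tendsto_cong)
qed

text \<open>In an ultrametric space the distance covered by many steps is at most the largest single
  step, so steps tending to 0 already give a Cauchy sequence.\<close>

lemma convergent_nonarch:
  fixes X :: "nat \<Rightarrow> 'a::complete_nonarch_field"
  assumes "(\<lambda>n. vabs (X (Suc n) - X n)) \<longlonglongrightarrow> 0"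
  shows "convergent X"
proof -
  have "Cauchy X"
    unfolding Cauchy_altdef2
  proof (intro allI impI)
    fix e :: real
    assume "e > 0"
    then obtain N where N: "\<And>n. n \<ge> N \<Longrightarrow> vabs (X (Suc n) - X n) < e"
      using order_tendstoD(2)[OF assms] by (auto simp: eventually_sequentially)
    have "vabs (X n - X N) < e" if "n \<ge> N" for n
      using that
    proof (induction n rule: dec_induct)
      case (step n)
      then show ?case
        using vabs_add[of "X (Suc n) - X n" "X n - X N"] N[of n] by simp
    qed (use \<open>e > 0\<close> in simp)
    then show "\<exists>N. \<forall>n\<ge>N. dist (X n) (X N) < e"
      by (auto simp: dist_vabs)
  qed
  then show ?thesis
    by (rule Cauchy_convergent)
qed

lemma summable_nonarch:
  fixes f :: "nat \<Rightarrow> 'a::complete_nonarch_field"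
  assumes "\<And>n. vabs (f n) \<le> b n" and "b \<longlonglongrightarrow> 0"
  shows "summable f"
  unfolding summable_iff_convergent
proof (rule convergent_nonarch)
  show "(\<lambda>n. vabs (sum f {..<Suc n} - sum f {..<n})) \<longlonglongrightarrow> 0"
    by (rule tendsto_sandwich[OF _ _ tendsto_const assms(2)]) (auto simp: assms(1))
qed

text \<open>Every finite stretch of terms from \<open>k\<close> on is bounded by \<open>B\<close>
  itself, with no growth in the number of terms, and the bound survives the limit.\<close>

lemma vabs_suminf_diff_le:
  fixes f :: "nat \<Rightarrow> 'a::complete_nonarch_field"
  assumes "summable f" and "\<And>n. n \<ge> k \<Longrightarrow> vabs (f n) \<le> B" and "0 \<le> B"
  shows "vabs (suminf f - sum f {..<k}) \<le> B"
proof (rule LIMSEQ_le_const2)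
  show "(\<lambda>n. vabs (sum f {..<n} - sum f {..<k})) \<longlonglongrightarrow> vabs (suminf f - sum f {..<k})"
    by (intro tendsto_vabs tendsto_diff tendsto_const summable_LIMSEQ assms(1))
  have "vabs (sum f {..<n} - sum f {..<k}) \<le> B" if "n \<ge> k" for n
  proof -
    have "sum f {..<n} - sum f {..<k} = sum f {k..<n}"
      using that by (simp add: lessThan_atLeast0 sum_diff_nat_ivl)
    then show ?thesis
      using assms by (auto intro: vabs_sum_le)
  qed
  then show "\<exists>N. \<forall>n\<ge>N. vabs (sum f {..<n} - sum f {..<k}) \<le> B"
    by blast
qed

text \<open>Dominated convergence for series. The dominating sequence only has to tend to 0: beyond
  some \<open>K\<close> all terms are uniformly small, and finitely many indices remain.\<close>

lemma nonarch_Tannery: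
  fixes a :: "nat \<Rightarrow> nat \<Rightarrow> 'a::complete_nonarch_field"
  assumes bound: "\<And>n k. vabs (a n k) \<le> b k" and "b \<longlonglongrightarrow> 0"
    and lim: "\<And>k. (\<lambda>n. a n k) \<longlonglongrightarrow> c k"
  shows "(\<lambda>n. suminf (a n)) \<longlonglongrightarrow> suminf c"
proof -
  have bound_c: "vabs (c k) \<le> b k" for k
    by (rule LIMSEQ_le_const2[OF tendsto_vabs[OF lim]]) (use bound in auto)
  have summable: "summable (a n)" "summable c" for n
    by (rule summable_nonarch[OF bound \<open>b \<longlonglongrightarrow> 0\<close>], rule summable_nonarch[OF bound_c \<open>b \<longlonglongrightarrow> 0\<close>])
  have "eventually (\<lambda>n. vabs (suminf (a n) - suminf c) < e) sequentially" if "e > 0" for e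
  proof -
    from \<open>e > 0\<close> have "e / 2 > 0" by simp
    \<comment> \<open>Half of \<open>e\<close> leaves room: the estimate for the whole series is
      only non-strict, while the goal is strict.\<close>
    then obtain K where K: "\<And>k. k \<ge> K \<Longrightarrow> b k < e / 2"
      using order_tendstoD(2)[OF \<open>b \<longlonglongrightarrow> 0\<close>] unfolding eventually_sequentially by blast
    have "eventually (\<lambda>n. \<forall>k\<in>{..<K}. vabs (a n k - c k) < e / 2) sequentially"
      using \<open>e / 2 > 0\<close> by (intro eventually_ball_finite ballI order_tendstoD(2)[where y = 0]
        tendsto_vabs_iff[THEN iffD1] lim) auto
    then show ?thesis
    proof eventually_elim
      case (elim n)
      have "vabs (a n k - c k) \<le> e / 2" for k
      proof (cases "k < K")
        case False
        then show ?thesis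
          using vabs_diff[of "a n k" "c k"] bound[of n k] bound_c[of k] K[of k] by auto
      qed (use elim in force)
      moreover have "(\<lambda>k. a n k - c k) sums (suminf (a n) - suminf c)"
        unfolding sums_def sum_subtractf by (intro tendsto_diff summable_LIMSEQ summable)
      ultimately have "vabs (suminf (a n) - suminf c) \<le> e / 2"
        using vabs_suminf_diff_le[of "\<lambda>k. a n k - c k" 0 "e / 2"] \<open>e / 2 > 0\<close>
        by (simp add: sums_iff)
      with \<open>e > 0\<close> show ?case by simp
    qed
  qed
  then show ?thesis
    unfolding tendsto_vabs_iff by (intro order_tendstoI) (auto intro!: always_eventually intro: less_le_trans[OF _ vabs_nonneg])
qed

section \<open>The p-adic exponential and logarithm\<close>

locale padic_valued =
  fixes p :: nat and K :: "'a::complete_nonarch_field itself"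
  assumes prime_p: "prime p"
    and vabs_of_nat: "n > 0 \<Longrightarrow> vabs (of_nat n :: 'a) = 1 / real p ^ multiplicity p n"
begin

text \<open>The radius of convergence of the p-adic exponential series, and the bound imposed on
  \<open>1 - q\<close>.\<close>

definition rad :: real where
  "rad = real p powr (- 1 / (real p - 1))"

lemma p_gt_1: "1 < p"
  by (rule prime_gt_1_nat[OF prime_p])

lemma rad_pos: "0 < rad"
  using p_gt_1 by (simp add: rad_def)

lemma rad_less_1: "rad < 1"
  using p_gt_1 by (simp add: rad_def powr_less_one)

text \<open>Trades a factor \<open>1 / p\<close> for \<open>p - 1\<close> factors \<open>rad\<close>
  in the estimate of factorials.\<close>

lemma rad_power: "rad ^ (p - 1) = 1 / real p"
proof -
  have "rad ^ (p - 1) = rad powr (real p - 1)"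
    using p_gt_1 rad_pos by (simp flip: powr_realpow)
  also have "\<dots> = real p powr (- 1)"
    unfolding rad_def powr_powr using p_gt_1 by simp
  finally show ?thesis
    using p_gt_1 by (simp add: powr_minus_divide)
qed

lemma vabs_of_p: "vabs (of_nat p :: 'a) = 1 / real p"
  using vabs_of_nat[of p] prime_p p_gt_1 by simp

section \<open>The p-adic size of factorials\<close>

lemma vabs_of_nat_coprime: "\<not> p dvd n \<Longrightarrow> vabs (of_nat n :: 'a) = 1"
  using vabs_of_nat[of n] by (cases "n = 0") (auto simp: not_dvd_imp_multiplicity_0)

lemma vabs_fact_mult_add:
  assumes "j < p"
  shows "vabs (fact (p * m + j) :: 'a) = vabs (fact (p * m) :: 'a)"
  using assms
proof (induction j)
  case (Suc j)
  have "\<not> p dvd Suc (p * m + j)"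
    using Suc.prems by (metis add_Suc_right dvd_add_right_iff dvd_triv_left nat_dvd_not_less zero_less_Suc)
  then show ?case
    using Suc vabs_of_nat_coprime[of "Suc (p * m + j)"] by (simp add: vabs_mult)
qed simp

text \<open>Only the multiples of \<open>p\<close> up to \<open>p * m\<close> count, and their
  product is \<open>p ^ m * fact m\<close>.\<close>

lemma vabs_fact_mult: "vabs (fact (p * m) :: 'a) = (1 / real p) ^ m * vabs (fact m :: 'a)"
proof (induction m)
  case (Suc m)
  have "p * Suc m = Suc (p * m + (p - 1))"
    using p_gt_1 by simp
  then have "vabs (fact (p * Suc m) :: 'a)
      = vabs (of_nat (p * Suc m) :: 'a) * vabs (fact (p * m + (p - 1)) :: 'a)"
    by (metis fact_Suc vabs_mult)
  also have "\<dots> = vabs (of_nat p * of_nat (Suc m) :: 'a) * vabs (fact (p * m) :: 'a)"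
    using p_gt_1 by (simp only: vabs_fact_mult_add of_nat_mult)
  also have "\<dots> = (1 / real p) ^ Suc m * (vabs (of_nat (Suc m) :: 'a) * vabs (fact m :: 'a))"
    unfolding vabs_mult vabs_of_p Suc.IH by (simp del: of_nat_Suc)
  finally show ?case
    by (simp only: fact_Suc vabs_mult)
qed simp

text \<open>A form of Legendre's bound: the exponent of \<open>p\<close> in
  \<open>fact (Suc n)\<close> is at most \<open>n / (p - 1)\<close>. The gain of one in the index
  later keeps a free factor \<open>vabs x\<close> in front of the term estimates.\<close>

lemma vabs_fact_ge: "rad ^ n \<le> vabs (fact (Suc n) :: 'a)"
proof (induction n rule: less_induct)
  case (less n)
  define m j where "m = Suc n div p" and "j = Suc n mod p"
  have n: "Suc n = p * m + j" and "j < p"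
    using p_gt_1 by (auto simp: m_def j_def)
  have fact: "vabs (fact (Suc n) :: 'a) = (1 / real p) ^ m * vabs (fact m :: 'a)"
    unfolding n using vabs_fact_mult_add[OF \<open>j < p\<close>] vabs_fact_mult by simp
  show ?case
  proof (cases m)
    case 0
    then show ?thesis
      using fact rad_pos rad_less_1 by (simp add: power_le_one)
  next
    case (Suc k)
    \<comment> \<open>Exponent count: the \<open>Suc k\<close> factors \<open>1 / p\<close> are
      worth \<open>(p - 1) * Suc k\<close> powers of \<open>rad\<close>, and the induction
      hypothesis for \<open>fact (Suc k)\<close> supplies \<open>k\<close> more.\<close>
    have eq: "(p - 1) * Suc k + k = p * Suc k - 1"
      using p_gt_1 by (cases p) auto
    have "p * Suc k - 1 \<le> n"
      using n unfolding Suc by linarith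
    moreover have "1 * Suc k \<le> (p - 1) * Suc k"
      using p_gt_1 by (intro mult_le_mono1) linarith
    ultimately have "k < n"
      unfolding eq[symmetric] mult_1 by (meson Suc_le_eq add_leD1 order_trans)
    have "rad ^ n \<le> rad ^ (p * Suc k - 1)"
      using \<open>p * Suc k - 1 \<le> n\<close> rad_pos rad_less_1 by (intro power_decreasing) auto
    also have "\<dots> = (1 / real p) ^ Suc k * rad ^ k"
      by (simp only: eq[symmetric] power_add power_mult rad_power)
    also have "\<dots> \<le> (1 / real p) ^ Suc k * vabs (fact (Suc k) :: 'a)"
      using less.IH[OF \<open>k < n\<close>] by (intro mult_left_mono) auto
    finally show ?thesis
      by (simp only: fact Suc)
  qed
qed

text \<open>Dividing \<open>fact (Suc n)\<close> by \<open>fact n\<close>, whose absolute value is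
  at most 1, can only increase the absolute value.\<close>

lemma vabs_of_nat_ge: "rad ^ n \<le> vabs (of_nat (Suc n) :: 'a)"
proof -
  have "vabs (fact n :: 'a) \<le> 1"
    using vabs_of_nat_le_1[of "fact n"] by simp
  then have "vabs (of_nat (Suc n) :: 'a) * vabs (fact n :: 'a) \<le> vabs (of_nat (Suc n) :: 'a)"
    by (intro mult_left_le) auto
  with vabs_fact_ge[of n] show ?thesis
    by (simp only: fact_Suc vabs_mult of_nat_fact)
qed

text \<open>Serves both series: \<open>d\<close> is a factorial for the exponential and an integer
  for the logarithm.\<close>

lemma vabs_power_div_le:
  assumes "rad ^ n \<le> vabs d"
  shows "vabs (x ^ Suc n / d) \<le> vabs x * (vabs x / rad) ^ n"
proof -
  have "vabs (x ^ Suc n / d) = vabs x * (vabs x ^ n / vabs d)"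
    by (simp add: vabs_divide vabs_mult vabs_power)
  also have "\<dots> \<le> vabs x * (vabs x ^ n / rad ^ n)"
    using assms rad_pos by (intro mult_left_mono divide_left_mono mult_pos_pos)
      (auto simp del: vabs_pos_iff intro: less_le_trans[OF zero_less_power])
  finally show ?thesis
    by (simp add: power_divide)
qed

section \<open>The exponential: estimates and functional equation\<close>

lemma tendsto_geometric:
  assumes "vabs x < rad"
  shows "(\<lambda>n. c * (vabs x / rad) ^ n) \<longlonglongrightarrow> 0"
  using assms rad_pos by (intro tendsto_mult_right_zero LIMSEQ_power_zero) auto

lemma vabs_exp_term_le: "vabs (x ^ Suc n / fact (Suc n) :: 'a) \<le> vabs x * (vabs x / rad) ^ n"
  by (rule vabs_power_div_le[OF vabs_fact_ge])

lemma tendsto_exp_terms: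
  assumes "vabs (x :: 'a) < rad"
  shows "(\<lambda>n. vabs (x ^ n / fact n)) \<longlonglongrightarrow> 0"
proof (rule LIMSEQ_imp_Suc)
  show "(\<lambda>n. vabs (x ^ Suc n / fact (Suc n))) \<longlonglongrightarrow> 0"
    by (rule tendsto_sandwich[OF _ _ tendsto_const tendsto_geometric[OF assms, of "vabs x"]])
      (auto intro!: always_eventually vabs_exp_term_le simp del: power_Suc fact_Suc)
qed

lemma summable_exp:
  assumes "vabs (x :: 'a) < rad"
  shows "summable (\<lambda>n. x ^ n / fact n)"
  by (rule summable_nonarch[OF order.refl tendsto_exp_terms[OF assms]])

text \<open>Each term of degree at least 2 carries a factor \<open>vabs x / rad\<close> beyond
  \<open>vabs x\<close>. This quadratic error is what lets \<open>padic_log_exp\<close> divide by a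
  power of \<open>p\<close> and still reach a limit.\<close>

lemma vabs_padic_exp_second_order:
  assumes "vabs (x :: 'a) < rad"
  shows "vabs (padic_exp x - 1 - x) \<le> vabs x * (vabs x / rad)"
proof -
  have "vabs (x ^ n / fact n) \<le> vabs x * (vabs x / rad)" if n: "n \<ge> 2" for n
  proof -
    obtain k where k: "n = Suc (Suc k)"
      using n by (metis add_2_eq_Suc le_Suc_ex)
    have "(vabs x / rad) ^ Suc k \<le> (vabs x / rad) ^ 1"
      using assms rad_pos by (intro power_decreasing) auto
    then have "vabs x * (vabs x / rad) ^ Suc k \<le> vabs x * (vabs x / rad)"
      by (intro mult_left_mono) auto
    then show ?thesis
      unfolding k using vabs_exp_term_le[of x "Suc k"] by linarith
  qed
  then have "vabs (padic_exp x - (\<Sum>n<2. x ^ n / fact n)) \<le> vabs x * (vabs x / rad)"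
    unfolding padic_exp_def using rad_pos
    by (intro vabs_suminf_diff_le summable_exp assms) auto
  moreover have "padic_exp x - (\<Sum>n<2. x ^ n / fact n) = padic_exp x - 1 - x"
    by (simp add: numeral_2_eq_2)
  ultimately show ?thesis
    by simp
qed

lemma vabs_padic_exp_minus_1:
  assumes "vabs (x :: 'a) < rad"
  shows "vabs (padic_exp x - 1) \<le> vabs x"
proof -
  have "vabs x * (vabs x / rad) \<le> vabs x"
    using assms rad_pos by (intro mult_left_le) auto
  then show ?thesis
    using vabs_padic_exp_second_order[OF assms] vabs_add[of "padic_exp x - 1 - x" x]
    by (simp add: max_def split: if_splits)
qed

lemma padic_exp_0 [simp]: "padic_exp (0 :: 'a) = 1"
  using vabs_padic_exp_minus_1[of 0] rad_pos by simp

lemma vabs_padic_exp_le_1: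
  assumes "vabs (x :: 'a) < rad"
  shows "vabs (padic_exp x) \<le> 1"
  using vabs_padic_exp_minus_1[OF assms] vabs_add[of "padic_exp x - 1" 1] assms rad_less_1
  by (simp add: max_def split: if_splits)

lemma vabs_add_less: "vabs x < rad \<Longrightarrow> vabs y < rad \<Longrightarrow> vabs (x + y) < rad"
  using vabs_add[of x y] by (simp add: max_def split: if_splits)

lemma vabs_of_nat_mult_less: "vabs (x :: 'a) < rad \<Longrightarrow> vabs (of_nat n * x) < rad"
  using mult_right_mono[OF vabs_of_nat_le_1[where 'a = 'a, of n], of "vabs x"]
  by (simp add: vabs_mult)

text \<open>Since \<open>rad < 1\<close>, the leading \<open>vabs x\<close> is at most
  \<open>vabs x / rad\<close>. The resulting pure power multiplies well in the Cauchy product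
  below.\<close>

lemma vabs_exp_term_le_geometric:
  assumes "vabs (x :: 'a) \<le> B" "B < rad"
  shows "vabs (x ^ n / fact n) \<le> (B / rad) ^ n"
proof (cases n)
  case (Suc k)
  have "vabs x * (vabs x / rad) ^ k \<le> (vabs x / rad) * (vabs x / rad) ^ k"
    using rad_pos rad_less_1 by (intro mult_right_mono) (auto simp: field_simps mult_left_le)
  also have "\<dots> = (vabs x / rad) ^ n"
    by (simp add: Suc)
  also have "\<dots> \<le> (B / rad) ^ n"
    using assms rad_pos by (intro power_mono divide_right_mono) auto
  finally show ?thesis
    unfolding Suc using vabs_exp_term_le[of x k] by linarith
qed simp

lemma exp_series_add:
  "(\<Sum>i\<le>k. (x ^ i / fact i) * (y ^ (k - i) / fact (k - i))) = (x + y :: 'a) ^ k / fact k"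
proof -
  have "(x ^ i / fact i) * (y ^ (k - i) / fact (k - i))
      = of_nat (k choose i) * x ^ i * y ^ (k - i) / fact k" if "i \<le> k" for i
    using that by (simp add: binomial_fact field_simps)
  then show ?thesis
    by (simp add: binomial_ring sum_divide_distrib)
qed

text \<open>The product of partial sums runs over a square of index pairs, the partial sum at
  \<open>x + y\<close> over the triangle \<open>i + j < n\<close>. Each remaining term has
  \<open>i + j \<ge> n\<close> and is at most \<open>(B / rad) ^ n\<close>, so the difference tends
  to 0.\<close>

lemma padic_exp_add:
  assumes "vabs (x :: 'a) < rad" "vabs y < rad"
  shows "padic_exp (x + y) = padic_exp x * padic_exp y"
proof -
  define B where "B = max (vabs x) (vabs y)"
  have B: "vabs x \<le> B" "vabs y \<le> B" "B < rad" "0 \<le> B"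
    using assms by (auto simp: B_def le_max_iff_disj)
  let ?E = "\<lambda>z n. \<Sum>k<n. z ^ k / fact k :: 'a"
  have lim: "?E z \<longlonglongrightarrow> padic_exp z" if "vabs z < rad" for z
    unfolding padic_exp_def by (rule summable_LIMSEQ[OF summable_exp[OF that]])
  have "vabs (?E x n * ?E y n - ?E (x + y) n) \<le> (B / rad) ^ n" for n
  proof -
    let ?g = "\<lambda>(i, j). (x ^ i / fact i) * (y ^ j / fact j)"
    let ?T = "{(i, j). i + j < n}" and ?S = "{..<n} \<times> {..<n}"
    have "?E x n * ?E y n = sum ?g ?S"
      by (simp add: sum_product sum.cartesian_product)
    moreover have "?E (x + y) n = sum ?g ?T"
      by (simp only: sum.triangle_reindex exp_series_add)
    moreover have "sum ?g ?S - sum ?g ?T = sum ?g (?S - ?T)"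
      by (rule sum_diff[symmetric]) auto
    moreover have "vabs (sum ?g (?S - ?T)) \<le> (B / rad) ^ n"
    proof (rule vabs_sum_le)
      fix ij assume "ij \<in> ?S - ?T"
      then obtain i j where ij: "ij = (i, j)" "n \<le> i + j"
        by (auto simp: not_less)
      have "vabs (?g ij) = vabs (x ^ i / fact i) * vabs (y ^ j / fact j)"
        by (simp only: ij prod.case vabs_mult)
      also have "\<dots> \<le> (B / rad) ^ i * (B / rad) ^ j"
        using B rad_pos by (intro mult_mono vabs_exp_term_le_geometric) auto
      also have "\<dots> \<le> (B / rad) ^ n"
        unfolding power_add[symmetric] using B rad_pos ij by (intro power_decreasing) auto
      finally show "vabs (?g ij) \<le> (B / rad) ^ n" .
    qed (use B rad_pos in auto)
    ultimately show ?thesis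
      by simp
  qed
  then have "(\<lambda>n. ?E x n * ?E y n - ?E (x + y) n) \<longlonglongrightarrow> 0"
    using B rad_pos by (intro tendsto_of_vabs_le[OF _ LIMSEQ_power_zero[of "B / rad"]]) auto
  moreover have "(\<lambda>n. ?E x n * ?E y n - ?E (x + y) n)
      \<longlonglongrightarrow> padic_exp x * padic_exp y - padic_exp (x + y)"
    by (intro tendsto_diff tendsto_mult lim assms vabs_add_less)
  ultimately show ?thesis
    using LIMSEQ_unique by fastforce
qed

lemma padic_exp_of_nat_mult:
  assumes "vabs (x :: 'a) < rad"
  shows "padic_exp (of_nat n * x) = padic_exp x ^ n"
proof (induction n)
  case (Suc n)
  then show ?case
    using padic_exp_add[OF assms vabs_of_nat_mult_less[OF assms]] by (simp add: distrib_right)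
qed simp

section \<open>The logarithm as a limit of difference quotients\<close>

lemma vabs_log_term_le:
  "vabs (x ^ Suc n / of_nat (Suc n) :: 'a) \<le> vabs x * (vabs x / rad) ^ n"
  by (rule vabs_power_div_le[OF vabs_of_nat_ge])

text \<open>Ensures that integer multiples of \<open>padic_log q\<close> stay in the domain of the
  exponential. The leading term dominates, so the logarithm is no larger than
  \<open>q - 1\<close>.\<close>

lemma vabs_log_less:
  assumes "vabs (q - 1 :: 'a) < rad"
  shows "vabs (padic_log q) < rad"
proof -
  have le: "vabs ((-1) ^ n * (q - 1) ^ Suc n / of_nat (Suc n)) \<le> vabs (q - 1) * (vabs (q - 1) / rad) ^ n" for n
    using vabs_log_term_le[of "q - 1" n] by (simp add: vabs_mult vabs_divide vabs_power)
  moreover have "vabs (q - 1) * (vabs (q - 1) / rad) ^ n \<le> vabs (q - 1)" for n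
    using assms rad_pos by (intro mult_left_le power_le_one) auto
  ultimately have "vabs ((-1) ^ n * (q - 1) ^ Suc n / of_nat (Suc n)) \<le> vabs (q - 1)" for n
    using order_trans by blast
  then have "vabs (padic_log q) \<le> vabs (q - 1)"
    using vabs_suminf_diff_le[OF summable_nonarch[OF le tendsto_geometric[OF assms]], of 0 "vabs (q - 1)"]
    by (simp only: padic_log_def vabs_nonneg lessThan_0 sum.empty diff_zero)
  with assms show ?thesis
    by simp
qed

lemma tendsto_p_power: "(\<lambda>N. of_nat (p ^ N) :: 'a) \<longlonglongrightarrow> 0"
proof (rule tendsto_of_vabs_le)
  show "vabs (of_nat (p ^ N) - 0 :: 'a) \<le> (1 / real p) ^ N" for N
    by (simp add: vabs_power vabs_of_p)
  show "(\<lambda>N. (1 / real p) ^ N) \<longlonglongrightarrow> 0"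
    using p_gt_1 by (intro LIMSEQ_power_zero) auto
qed

lemma of_nat_choose_Suc:
  "of_nat (Suc M choose Suc k) = (of_nat (Suc M) * of_nat (M choose k) / of_nat (Suc k) :: 'a)"
proof -
  have "of_nat (Suc k * (Suc M choose Suc k)) = (of_nat (Suc M * (M choose k)) :: 'a)"
    by (simp only: Suc_times_binomial_eq mult.commute)
  then show ?thesis
    by (simp only: of_nat_mult) (simp add: field_simps del: of_nat_Suc)
qed

text \<open>As \<open>p ^ N\<close> tends to 0, the limit is the binomial coefficient of -1 over
  \<open>k\<close>. In Pascal's rule the coefficient with upper index \<open>p ^ N\<close> contains
  the vanishing factor \<open>p ^ N\<close>.\<close>

lemma tendsto_choose:
  "(\<lambda>N. of_nat ((p ^ N - 1) choose k) :: 'a) \<longlonglongrightarrow> (-1) ^ k"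
proof (induction k)
  case (Suc k)
  have pN: "p ^ N = Suc (p ^ N - 1)" for N
    using p_gt_1 by simp
  have eq: "of_nat ((p ^ N - 1) choose Suc k)
      = (of_nat (p ^ N) * of_nat ((p ^ N - 1) choose k) * inverse (of_nat (Suc k))
        - of_nat ((p ^ N - 1) choose k) :: 'a)" for N
    using of_nat_choose_Suc[of "p ^ N - 1" k] pN[of N]
    by (simp add: field_simps del: of_nat_Suc)
  have "(\<lambda>N. of_nat ((p ^ N - 1) choose Suc k) :: 'a)
      \<longlonglongrightarrow> 0 * (-1) ^ k * inverse (of_nat (Suc k)) - (-1) ^ k"
    unfolding eq by (intro tendsto_intros tendsto_p_power Suc.IH)
  then show ?case
    by simp
qed simp

text \<open>Absorption cancels the denominator \<open>Suc M\<close>. The finite sum is written as a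
  series, zero beyond \<open>M\<close>, so that \<open>nonarch_Tannery\<close> applies.\<close>

lemma power_minus_1_quotient:
  fixes u :: 'a
  shows "((1 + u) ^ Suc M - 1) / of_nat (Suc M)
    = (\<Sum>k. of_nat (M choose k) * u ^ Suc k / of_nat (Suc k))"
proof -
  have "(1 + u) ^ Suc M = (\<Sum>k\<le>Suc M. of_nat (Suc M choose k) * u ^ k)"
    by (subst add.commute, subst binomial_ring) simp
  also have "\<dots> = 1 + (\<Sum>k\<le>M. of_nat (Suc M choose Suc k) * u ^ Suc k)"
    by (subst sum.atMost_Suc_shift) simp
  also have "(\<Sum>k\<le>M. of_nat (Suc M choose Suc k) * u ^ Suc k)
      = of_nat (Suc M) * (\<Sum>k\<le>M. of_nat (M choose k) * u ^ Suc k / of_nat (Suc k))"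
    unfolding of_nat_choose_Suc sum_distrib_left
    by (simp add: mult.assoc del: of_nat_Suc power_Suc)
  finally have "((1 + u) ^ Suc M - 1) / of_nat (Suc M)
      = (\<Sum>k\<le>M. of_nat (M choose k) * u ^ Suc k / of_nat (Suc k))"
    by (simp del: of_nat_Suc power_Suc)
  also have "\<dots> = (\<Sum>k. of_nat (M choose k) * u ^ Suc k / of_nat (Suc k))"
    by (rule suminf_finite[symmetric]) (auto simp: binomial_eq_0)
  finally show ?thesis .
qed

text \<open>Expand binomially and pass to the limit termwise.\<close>

lemma tendsto_padic_log:
  assumes "vabs (q - 1 :: 'a) < rad"
  shows "(\<lambda>N. (q ^ (p ^ N) - 1) / of_nat (p ^ N)) \<longlonglongrightarrow> padic_log q"
proof -
  let ?u = "q - 1"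
  have pN: "Suc (p ^ N - 1) = p ^ N" for N
    using p_gt_1 by simp
  have eq: "(q ^ (p ^ N) - 1) / of_nat (p ^ N)
      = (\<Sum>k. of_nat ((p ^ N - 1) choose k) * ?u ^ Suc k / of_nat (Suc k))" for N
    using power_minus_1_quotient[of ?u "p ^ N - 1"] unfolding pN by simp
  show ?thesis
    unfolding eq padic_log_def
  proof (rule nonarch_Tannery[OF _ tendsto_geometric[OF assms]])
    fix N k
    have "vabs (of_nat ((p ^ N - 1) choose k) * (?u ^ Suc k / of_nat (Suc k)))
        \<le> 1 * (vabs ?u * (vabs ?u / rad) ^ k)"
      unfolding vabs_mult using vabs_of_nat_le_1 vabs_log_term_le by (intro mult_mono) auto
    then show "vabs (of_nat ((p ^ N - 1) choose k) * ?u ^ Suc k / of_nat (Suc k))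
        \<le> vabs ?u * (vabs ?u / rad) ^ k"
      by simp
    show "(\<lambda>N. of_nat ((p ^ N - 1) choose k) * ?u ^ Suc k / of_nat (Suc k))
        \<longlonglongrightarrow> (-1) ^ k * ?u ^ Suc k / of_nat (Suc k)"
      unfolding divide_inverse by (intro tendsto_intros tendsto_choose)
  qed
qed

text \<open>Avoids composing power series: the logarithm is a limit of quotients, and
  \<open>padic_exp y ^ (p ^ N)\<close> is \<open>padic_exp (M * y)\<close> with
  \<open>M = p ^ N\<close>. This equals \<open>1 + M * y\<close> up to an error quadratic in
  \<open>M\<close>, so one factor \<open>M\<close> survives the division.\<close>

lemma padic_log_exp:
  assumes "vabs (y :: 'a) < rad"
  shows "padic_log (padic_exp y) = y"
proof -
  have "vabs (padic_exp y - 1) < rad"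
    using vabs_padic_exp_minus_1[OF assms] assms by simp
  then have "(\<lambda>N. (padic_exp y ^ (p ^ N) - 1) / of_nat (p ^ N)) \<longlonglongrightarrow> padic_log (padic_exp y)"
    by (rule tendsto_padic_log)
  moreover have "(\<lambda>N. (padic_exp y ^ (p ^ N) - 1) / of_nat (p ^ N)) \<longlonglongrightarrow> y"
  proof (rule tendsto_of_vabs_le)
    fix N
    define M :: 'a where "M = of_nat (p ^ N)"
    have "M \<noteq> 0"
      using p_gt_1 by (simp add: M_def)
    have "(padic_exp y ^ (p ^ N) - 1) / M - y = (padic_exp (M * y) - 1 - M * y) / M"
      using \<open>M \<noteq> 0\<close> padic_exp_of_nat_mult[OF assms, of "p ^ N"] by (simp add: M_def field_simps)
    then have "vabs ((padic_exp y ^ (p ^ N) - 1) / M - y)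
        \<le> vabs (M * y) * (vabs (M * y) / rad) / vabs M"
      unfolding M_def vabs_divide
      using vabs_padic_exp_second_order[OF vabs_of_nat_mult_less[OF assms, of "p ^ N"]]
      by (simp only: vabs_divide divide_right_mono vabs_nonneg)
    also have "\<dots> = vabs y * vabs y / rad * vabs M"
      using \<open>M \<noteq> 0\<close> by (simp add: vabs_mult field_simps)
    finally show "vabs ((padic_exp y ^ (p ^ N) - 1) / of_nat (p ^ N) - y)
        \<le> vabs y * vabs y / rad * vabs (of_nat (p ^ N) :: 'a)"
      by (simp add: M_def)
  next
    show "(\<lambda>N. vabs y * vabs y / rad * vabs (of_nat (p ^ N) :: 'a)) \<longlonglongrightarrow> 0"
      using tendsto_vabs[OF tendsto_p_power] by (intro tendsto_mult_right_zero) simp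
  qed
  ultimately show ?thesis
    by (rule LIMSEQ_unique)
qed

end

section \<open>Alternating sums and the fermionic integral\<close>

text \<open>The shift reverses the sign of every common term, so only the two ends remain.\<close>

lemma sum_alternating_telescope:
  fixes f :: "nat \<Rightarrow> 'a::comm_ring_1"
  shows "(\<Sum>x<M. (-1) ^ x * f (Suc x)) + (\<Sum>x<M. (-1) ^ x * f x) = f 0 - (-1) ^ M * f M"
  by (induction M) (auto simp: algebra_simps)

text \<open>Lipschitz continuity for the p-adic metric, restricted to the points that the integral
  samples. The form \<open>m + k\<close> avoids truncated subtraction.\<close>

definition nat_lipschitz :: "(nat \<Rightarrow> 'a::complete_nonarch_field) \<Rightarrow> bool" where
  "nat_lipschitz f \<longleftrightarrow> (\<exists>C. \<forall>m k. vabs (f (m + k) - f m) \<le> C * vabs (of_nat k :: 'a))"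

text \<open>Natural numbers have absolute value at most 1, so every value lies within a fixed
  distance of \<open>f 0\<close>. Boundedness is what products require.\<close>

lemma nat_lipschitz_bounded:
  assumes "nat_lipschitz f"
  obtains B where "B \<ge> 0" "\<And>m. vabs (f m) \<le> B"
proof -
  obtain C where C: "\<And>m k. vabs (f (m + k) - f m) \<le> C * vabs (of_nat k :: 'a)"
    using assms by (auto simp: nat_lipschitz_def)
  have "vabs (f m) \<le> max \<bar>C\<bar> (vabs (f 0))" for m
  proof -
    have "C * vabs (of_nat m :: 'a) \<le> \<bar>C\<bar> * 1"
      using vabs_of_nat_le_1[of m] by (intro mult_mono) auto
    with C[of 0 m] have "vabs (f m - f 0) \<le> \<bar>C\<bar>"
      by simp
    then show ?thesis
      using vabs_add[of "f m - f 0" "f 0"] by (simp add: max_def split: if_splits)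
  qed
  then show ?thesis
    using that[of "max \<bar>C\<bar> (vabs (f 0))"] by (simp add: le_max_iff_disj)
qed

lemma nat_lipschitz_const: "nat_lipschitz (\<lambda>_. c)"
  by (auto simp: nat_lipschitz_def intro: exI[of _ 0])

lemma nat_lipschitz_mult:
  fixes f g :: "nat \<Rightarrow> 'a::complete_nonarch_field"
  assumes "nat_lipschitz f" "nat_lipschitz g"
  shows "nat_lipschitz (\<lambda>x. f x * g x)"
proof -
  obtain A B where A: "A \<ge> 0" "\<And>m. vabs (f m) \<le> A" and B: "B \<ge> 0" "\<And>m. vabs (g m) \<le> B"
    using assms by (meson nat_lipschitz_bounded)
  obtain C D where C: "\<And>m k. vabs (f (m + k) - f m) \<le> C * vabs (of_nat k :: 'a)"
    and D: "\<And>m k. vabs (g (m + k) - g m) \<le> D * vabs (of_nat k :: 'a)"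
    using assms by (auto simp: nat_lipschitz_def)
  have "vabs (f (m + k) * g (m + k) - f m * g m) \<le> max (C * B) (A * D) * vabs (of_nat k :: 'a)" for m k
  proof -
    have "f (m + k) * g (m + k) - f m * g m = (f (m + k) - f m) * g (m + k) + f m * (g (m + k) - g m)"
      by (simp add: algebra_simps)
    then have "vabs (f (m + k) * g (m + k) - f m * g m)
        \<le> max (vabs (f (m + k) - f m) * vabs (g (m + k))) (vabs (f m) * vabs (g (m + k) - g m))"
      using vabs_add by (metis vabs_mult)
    also have "\<dots> \<le> max ((C * vabs (of_nat k :: 'a)) * B) (A * (D * vabs (of_nat k :: 'a)))"
      by (intro max.mono mult_mono A B C D vabs_nonneg order_trans[OF vabs_nonneg C])
    also have "\<dots> = max (C * B * vabs (of_nat k :: 'a)) (A * D * vabs (of_nat k :: 'a))"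
      by (simp only: mult_ac)
    also have "\<dots> = max (C * B) (A * D) * vabs (of_nat k :: 'a)"
      by (simp add: max_mult_distrib_right)
    finally show ?thesis .
  qed
  then show ?thesis
    unfolding nat_lipschitz_def by blast
qed

lemma nat_lipschitz_power: "nat_lipschitz f \<Longrightarrow> nat_lipschitz (\<lambda>x. f x ^ n)"
  by (induction n) (auto intro: nat_lipschitz_const nat_lipschitz_mult)

lemma nat_lipschitz_Suc: "nat_lipschitz f \<Longrightarrow> nat_lipschitz (\<lambda>x. f (Suc x))"
  unfolding nat_lipschitz_def by (metis add_Suc)

context padic_valued
begin

section \<open>Alternating sums of length p^N\<close>

lemma nat_lipschitz_tendsto:
  fixes f :: "nat \<Rightarrow> 'a"
  assumes "nat_lipschitz f"
  shows "(\<lambda>N. f (p ^ N)) \<longlonglongrightarrow> f 0"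
proof -
  obtain C where C: "\<And>m k. vabs (f (m + k) - f m) \<le> C * vabs (of_nat k :: 'a)"
    using assms by (auto simp: nat_lipschitz_def)
  show ?thesis
  proof (rule tendsto_of_vabs_le)
    show "vabs (f (p ^ N) - f 0) \<le> C * vabs (of_nat (p ^ N) :: 'a)" for N
      using C[of 0 "p ^ N"] by simp
    show "(\<lambda>N. C * vabs (of_nat (p ^ N) :: 'a)) \<longlonglongrightarrow> 0"
      using tendsto_vabs[OF tendsto_p_power] by (intro tendsto_mult_right_zero) simp
  qed
qed

text \<open>The range below \<open>p ^ Suc N\<close> splits into \<open>p\<close> blocks of length
  \<open>p ^ N\<close>. This length is odd, so block \<open>j\<close> carries the sign
  \<open>(-1) ^ j\<close>. Comparing each block with the first leaves differences of
  \<open>f\<close> at distance \<open>j * p ^ N\<close>, which tend to 0 uniformly.\<close>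

lemma convergent_alternating_sums:
  fixes f :: "nat \<Rightarrow> 'a"
  assumes "odd p" and "nat_lipschitz f"
  shows "convergent (\<lambda>N. \<Sum>x<p ^ N. (-1) ^ x * f x)"
proof (rule convergent_nonarch)
  let ?S = "\<lambda>N. \<Sum>x<p ^ N. (-1) ^ x * f x"
  obtain C0 where C0: "\<And>m k. vabs (f (m + k) - f m) \<le> C0 * vabs (of_nat k :: 'a)"
    using assms(2) by (auto simp: nat_lipschitz_def)
  define C where "C = \<bar>C0\<bar>"
  have C: "vabs (f (m + k) - f m) \<le> C * vabs (of_nat k :: 'a)" for m k
  proof -
    have "C0 * vabs (of_nat k :: 'a) \<le> C * vabs (of_nat k :: 'a)"
      unfolding C_def by (intro mult_right_mono) auto
    with C0[of m k] show ?thesis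
      by linarith
  qed
  have bound: "vabs (?S (Suc N) - ?S N) \<le> C * vabs (of_nat (p ^ N) :: 'a)" for N
  proof -
    have sign: "(-1) ^ (x + j * p ^ N) = (-1 :: 'a) ^ j * (-1) ^ x" for x j
      using assms(1) by (simp add: power_add power_mult uminus_power_if)
    have "(\<Sum>j<n. (-1 :: 'a) ^ j) = (if odd n then 1 else 0)" for n
      by (induction n) auto
    then have one: "(\<Sum>j<p. (-1 :: 'a) ^ j) = 1"
      using assms(1) by simp
    have "?S (Suc N) = (\<Sum>j<p. \<Sum>x=j * p ^ N..<j * p ^ N + p ^ N. (-1) ^ x * f x)"
      by (subst sum.nat_group) simp
    also have "\<dots> = (\<Sum>j<p. \<Sum>x<p ^ N. (-1) ^ (x + j * p ^ N) * f (x + j * p ^ N))"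
    proof (rule sum.cong[OF refl])
      show "(\<Sum>x=j * p ^ N..<j * p ^ N + p ^ N. (-1) ^ x * f x)
          = (\<Sum>x<p ^ N. (-1) ^ (x + j * p ^ N) * f (x + j * p ^ N))" for j
        using sum.shift_bounds_nat_ivl[of "\<lambda>x. (-1) ^ x * f x" 0 "j * p ^ N" "p ^ N"]
        by (simp only: lessThan_atLeast0 add.commute add_0_left)
    qed
    finally have Suc: "?S (Suc N) = (\<Sum>j<p. \<Sum>x<p ^ N. (-1) ^ j * (-1) ^ x * f (x + j * p ^ N))"
      unfolding sign .
    \<comment> \<open>The signs of the \<open>p\<close> blocks add up to 1 as \<open>p\<close> is
      odd; inserting this 1 gives \<open>?S N\<close> the same double-sum shape as
      \<open>?S (Suc N)\<close>.\<close>
    have "?S N = (\<Sum>j<p. (-1) ^ j) * ?S N"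
      by (simp only: one mult_1_left)
    also have "\<dots> = (\<Sum>j<p. \<Sum>x<p ^ N. (-1) ^ j * (-1) ^ x * f x)"
      by (simp only: sum_product mult.assoc)
    finally have N: "?S N = (\<Sum>j<p. \<Sum>x<p ^ N. (-1) ^ j * (-1) ^ x * f x)" .
    have "?S (Suc N) - ?S N
        = (\<Sum>j<p. \<Sum>x<p ^ N. (-1) ^ j * (-1) ^ x * (f (x + j * p ^ N) - f x))"
      unfolding Suc by (subst N) (simp only: sum_subtractf right_diff_distrib)
    also have "vabs \<dots> \<le> C * vabs (of_nat (p ^ N) :: 'a)"
    proof (intro vabs_sum_le)
      fix j x
      have "C * vabs (of_nat (j * p ^ N) :: 'a) \<le> C * (1 * vabs (of_nat (p ^ N) :: 'a))"
        unfolding of_nat_mult[of j] vabs_mult C_def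
        using vabs_of_nat_le_1 by (intro mult_mono) auto
      with C[of x "j * p ^ N"]
      show "vabs ((-1) ^ j * (-1) ^ x * (f (x + j * p ^ N) - f x)) \<le> C * vabs (of_nat (p ^ N) :: 'a)"
        by (simp add: vabs_mult vabs_power)
    qed (auto simp: C_def)
    finally show ?thesis .
  qed
  have lim: "(\<lambda>N. C * vabs (of_nat (p ^ N) :: 'a)) \<longlonglongrightarrow> 0"
    using tendsto_vabs[OF tendsto_p_power] by (intro tendsto_mult_right_zero) simp
  show "(\<lambda>N. vabs (?S (Suc N) - ?S N)) \<longlonglongrightarrow> 0"
    by (rule tendsto_sandwich[OF always_eventually always_eventually tendsto_const lim])
      (intro allI vabs_nonneg bound)+
qed

lemma alternating_sums_shift:
  fixes f :: "nat \<Rightarrow> 'a"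
  assumes "odd p" and "nat_lipschitz f"
  shows "lim (\<lambda>N. \<Sum>x<p ^ N. (-1) ^ x * f (Suc x)) + lim (\<lambda>N. \<Sum>x<p ^ N. (-1) ^ x * f x) = 2 * f 0"
proof -
  have "(\<lambda>N. (\<Sum>x<p ^ N. (-1) ^ x * f (Suc x)) + (\<Sum>x<p ^ N. (-1) ^ x * f x))
      \<longlonglongrightarrow> lim (\<lambda>N. \<Sum>x<p ^ N. (-1) ^ x * f (Suc x)) + lim (\<lambda>N. \<Sum>x<p ^ N. (-1) ^ x * f x)"
    using assms nat_lipschitz_Suc
    by (intro tendsto_add convergent_LIMSEQ_iff[THEN iffD1] convergent_alternating_sums) auto
  moreover have "f 0 - (-1) ^ (p ^ N) * f (p ^ N) = f 0 + f (p ^ N)" for N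
    using assms(1) by (simp add: uminus_power_if)
  then have "(\<lambda>N. (\<Sum>x<p ^ N. (-1) ^ x * f (Suc x)) + (\<Sum>x<p ^ N. (-1) ^ x * f x))
      \<longlonglongrightarrow> f 0 + f 0"
    unfolding sum_alternating_telescope
    by (simp only: tendsto_add tendsto_const nat_lipschitz_tendsto assms(2))
  ultimately show ?thesis
    unfolding mult_2 by (rule LIMSEQ_unique)
qed

section \<open>q-numbers on the natural numbers and the integral\<close>

lemma nat_lipschitz_exp:
  assumes "vabs (z :: 'a) < rad"
  shows "nat_lipschitz (\<lambda>x. padic_exp (of_nat x * z))"
proof -
  have "vabs (padic_exp (of_nat (m + k) * z) - padic_exp (of_nat m * z)) \<le> vabs z * vabs (of_nat k :: 'a)" for m k
  proof -
    \<comment> \<open>The functional equation isolates the increment: the first factor is at most 1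
      and the second at most \<open>vabs (of_nat k * z)\<close>.\<close>
    have "padic_exp (of_nat (m + k) * z) - padic_exp (of_nat m * z)
        = padic_exp (of_nat m * z) * (padic_exp (of_nat k * z) - 1)"
      using assms by (simp add: distrib_right padic_exp_add vabs_of_nat_mult_less right_diff_distrib)
    also have "vabs \<dots> \<le> 1 * vabs (of_nat k * z)"
      unfolding vabs_mult[of "padic_exp _"] using assms
      by (intro mult_mono vabs_padic_exp_le_1 vabs_padic_exp_minus_1 vabs_of_nat_mult_less) auto
    finally show ?thesis
      by (simp add: vabs_mult mult.commute)
  qed
  then show ?thesis
    unfolding nat_lipschitz_def by blast
qed

text \<open>With the base written as an exponential, \<open>padic_log_exp\<close> turns its powers
  into \<open>padic_exp (of_nat x * z)\<close>. Base 1 is separate because \<open>qnum\<close> is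
  then the identity.\<close>

lemma nat_lipschitz_qnum:
  assumes "vabs (z :: 'a) < rad"
  shows "nat_lipschitz (\<lambda>x. qnum (padic_exp z) (of_nat x))"
proof (cases "padic_exp z = 1")
  case True
  then show ?thesis
    by (auto simp: qnum_def nat_lipschitz_def intro: exI[of _ 1])
next
  case False
  obtain C where C: "\<And>m k. vabs (padic_exp (of_nat (m + k) * z) - padic_exp (of_nat m * z))
      \<le> C * vabs (of_nat k :: 'a)"
    using nat_lipschitz_exp[OF assms] unfolding nat_lipschitz_def by blast
  have "vabs (qnum (padic_exp z) (of_nat (m + k)) - qnum (padic_exp z) (of_nat m))
      \<le> C / vabs (1 - padic_exp z) * vabs (of_nat k :: 'a)" for m k
  proof -
    have "vabs (qnum (padic_exp z) (of_nat (m + k)) - qnum (padic_exp z) (of_nat m))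
        = vabs ((padic_exp (of_nat m * z) - padic_exp (of_nat (m + k) * z)) / (1 - padic_exp z))"
      using False assms by (simp add: qnum_def qpow_def padic_log_exp diff_divide_distrib)
    also have "\<dots> \<le> C * vabs (of_nat k :: 'a) / vabs (1 - padic_exp z)"
      unfolding vabs_divide using C[of m k]
      by (intro divide_right_mono) (auto simp: vabs_minus_commute)
    finally show ?thesis
      by simp
  qed
  then show ?thesis
    unfolding nat_lipschitz_def by blast
qed

lemma qnum_exp_0: "qnum (padic_exp (z :: 'a)) 0 = 0"
  by (simp add: qnum_def qpow_def)

lemma qnum_exp_2:
  assumes "vabs (z :: 'a) < rad"
  shows "qnum (padic_exp z) 2 = 1 + padic_exp z"
proof (cases "padic_exp z = 1")
  case False
  have "qpow (padic_exp z) 2 = padic_exp z ^ 2"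
    using padic_exp_of_nat_mult[OF assms, of 2] by (simp add: qpow_def padic_log_exp assms)
  then show ?thesis
    using False by (simp add: qnum_def field_simps power2_eq_square)
qed (simp add: qnum_def)

text \<open>The weight \<open>w\<close> cancels the powers of the base and leaves only signs. As
  \<open>p ^ N\<close> is odd, the normalising factor is \<open>(1 + Q) / (1 + Q ^ (p ^ N))\<close>
  for \<open>Q = padic_exp z\<close>, with limit \<open>(1 + Q) / 2\<close>.\<close>

lemma fermionic_integral_eq:
  fixes z :: 'a
  assumes "odd p" and z: "vabs z < rad" and w: "\<And>x. w (of_nat x) * padic_exp z ^ x = 1"
    and F: "nat_lipschitz (\<lambda>x. F (of_nat x))"
  shows "fermionic_integral p (padic_exp z) (\<lambda>t. w t * F t)
    = (1 + padic_exp z) / 2 * lim (\<lambda>N. \<Sum>x<p ^ N. (-1) ^ x * F (of_nat x))"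
proof -
  let ?Q = "padic_exp z" and ?S = "\<lambda>N. \<Sum>x<p ^ N. (-1) ^ x * F (of_nat x)"
  have "w (of_nat x) * F (of_nat x) * (- ?Q) ^ x = (-1) ^ x * F (of_nat x)" for x
  proof -
    have "w (of_nat x) * F (of_nat x) * (- ?Q) ^ x
        = (-1) ^ x * F (of_nat x) * (w (of_nat x) * ?Q ^ x)"
      by (simp add: power_minus[of ?Q] mult_ac)
    then show ?thesis
      by (simp add: w)
  qed
  moreover have "1 / qnum_neg ?Q (p ^ N) = (1 + ?Q) * inverse (1 + padic_exp (of_nat (p ^ N) * z))" for N
    using assms(1) unfolding padic_exp_of_nat_mult[OF z]
    by (simp add: qnum_neg_def divide_inverse uminus_power_if)
  ultimately have integral: "fermionic_integral p ?Q (\<lambda>t. w t * F t)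
      = lim (\<lambda>N. (1 + ?Q) * inverse (1 + padic_exp (of_nat (p ^ N) * z)) * ?S N)"
    unfolding fermionic_integral_def by (simp only:)
  have "(\<lambda>N. inverse (1 + padic_exp (of_nat (p ^ N) * z))) \<longlonglongrightarrow> inverse (1 + 1)"
    using nat_lipschitz_tendsto[OF nat_lipschitz_exp[OF z]]
    by (intro tendsto_nonarch_inverse tendsto_add tendsto_const) auto
  then have "(\<lambda>N. (1 + ?Q) * inverse (1 + padic_exp (of_nat (p ^ N) * z)) * ?S N)
      \<longlonglongrightarrow> (1 + ?Q) * inverse (1 + 1) * lim ?S"
    using convergent_alternating_sums[OF assms(1) F]
    by (intro tendsto_mult tendsto_const) (auto simp: convergent_LIMSEQ_iff)
  then show ?thesis
    unfolding integral one_add_one divide_inverse by (rule limI)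
qed

lemma genocchi_sum:
  fixes q :: 'a
  assumes "odd p" and q: "vabs (1 - q) < rad"
  shows "genocchi_poly p \<alpha> \<beta> q (Suc n) 1 + genocchi_num p \<alpha> \<beta> q (Suc n)
    = (if n = 0 then qnum (qpow q (of_nat \<beta>)) 2 else 0)"
proof -
  define a b where "a = of_nat \<alpha> * padic_log q" and "b = of_nat \<beta> * padic_log q"
  have "vabs (padic_log q) < rad"
    using q by (intro vabs_log_less) (simp add: vabs_minus_commute)
  then have a: "vabs a < rad" and b: "vabs b < rad"
    by (simp_all add: a_def b_def vabs_of_nat_mult_less)
  have base: "qpow q (of_nat \<alpha>) = padic_exp a" "qpow q (of_nat \<beta>) = padic_exp b"
    by (simp_all add: qpow_def a_def b_def)
  define f where "f = (\<lambda>x. qnum (padic_exp a) (of_nat x) ^ n)"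
  have f: "nat_lipschitz f"
    unfolding f_def by (intro nat_lipschitz_power nat_lipschitz_qnum a)
  have w: "qpow q (- of_nat \<beta> * of_nat x) * padic_exp b ^ x = 1" for x
  proof -
    have "vabs (of_nat x * b) < rad"
      by (rule vabs_of_nat_mult_less[OF b])
    then have "padic_exp (- (of_nat x * b)) * padic_exp (of_nat x * b) = 1"
      by (simp flip: padic_exp_add)
    moreover have "qpow q (- of_nat \<beta> * of_nat x) = padic_exp (- (of_nat x * b))"
      by (simp add: qpow_def b_def mult_ac)
    ultimately show ?thesis
      by (simp only: padic_exp_of_nat_mult[OF b])
  qed
  \<comment> \<open>Evaluating at 1 shifts the sampled function by one step, so both integrals
    involve the same \<open>f\<close>.\<close>
  have "genocchi_poly p \<alpha> \<beta> q (Suc n) 1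
      = of_nat (n + 1) * ((1 + padic_exp b) / 2 * lim (\<lambda>N. \<Sum>x<p ^ N. (-1) ^ x * f (Suc x)))"
    using fermionic_integral_eq[OF assms(1) b w, of "\<lambda>t. qnum (padic_exp a) (1 + t) ^ n"]
      nat_lipschitz_Suc[OF f]
    by (simp add: genocchi_poly_def base f_def)
  moreover have "genocchi_num p \<alpha> \<beta> q (Suc n)
      = of_nat (n + 1) * ((1 + padic_exp b) / 2 * lim (\<lambda>N. \<Sum>x<p ^ N. (-1) ^ x * f x))"
    using fermionic_integral_eq[OF assms(1) b w, of "\<lambda>t. qnum (padic_exp a) (0 + t) ^ n"] f
    by (simp add: genocchi_poly_def genocchi_num_def base f_def)
  ultimately have "genocchi_poly p \<alpha> \<beta> q (Suc n) 1 + genocchi_num p \<alpha> \<beta> q (Suc n)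
      = of_nat (n + 1) * ((1 + padic_exp b) / 2 * (2 * f 0))"
    unfolding alternating_sums_shift[OF assms(1) f, symmetric] by (simp only: distrib_left)
  \<comment> \<open>Here \<open>f 0\<close> is \<open>0 ^ n\<close>, which is 1 for
    \<open>n = 0\<close> and 0 otherwise.\<close>
  then show ?thesis
    using b by (simp add: f_def qnum_exp_0 qnum_exp_2 base)
qed

end

theorem theorem4:
  fixes p \<alpha> \<beta> :: nat and q :: "'a::complete_nonarch_field"
  assumes "prime p" and "odd p"
    and "is_Cp p TYPE('a)"
    and "vabs (1 - q) < real p powr (- 1 / (real p - 1))"
  shows "genocchi_num p \<alpha> \<beta> q 0 = 0 \<and>
    (\<forall>n\<ge>1. genocchi_poly p \<alpha> \<beta> q n 1 + genocchi_num p \<alpha> \<beta> q n =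
       (if n = 1 then qnum (qpow q (of_nat \<beta>)) 2 else 0))"
proof -
  interpret padic_valued p "TYPE('a)"
    using assms(1,3) by unfold_locales (auto simp: is_Cp_def)
  have "vabs (1 - q) < rad"
    using assms(4) by (simp add: rad_def)
  then have "genocchi_poly p \<alpha> \<beta> q n 1 + genocchi_num p \<alpha> \<beta> q n
      = (if n = 1 then qnum (qpow q (of_nat \<beta>)) 2 else 0)" if "n \<ge> 1" for n
    using genocchi_sum[OF assms(2), of q \<alpha> \<beta> "n - 1"] that by (cases n) auto
  \<comment> \<open>The generating function is a multiple of \<open>fps_X\<close>, so its constant
    coefficient vanishes.\<close>
  moreover have "genocchi_num p \<alpha> \<beta> q 0 = 0"
    by (simp add: genocchi_num_def genocchi_poly_def genocchi_gf_def)
  ultimately show ?thesis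
    by blast
qed

end
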